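(* Let $v_1,\ldots,v_s$ be discrete valuations of a Noetherian ring $R$. Let $a_1,\ldots,a_s\in\mathbb{R}_{>0}$, and define $\omega:R\setminus\{0\}\to\mathbb{R}_{\ge0}\cup\{\infty\}$ by $$\omega(f)=\min\left\{\frac{v_1(f)}{a_1},\ldots,\frac{v_s(f)}{a_s}\right\}.$$ If no $\frac{v_i}{a_i}$ can be omitted from this expression, then the $v_i$ and $a_i$ are uniquely determined by the function $\omega$, up to reindexing of the $\frac{v_i}{a_i}$. (That is: if also $\omega(f)=\min\{\frac{w_1(f)}{b_1},\ldots,\frac{w_t(f)}{b_t}\}$ for all $f\in R\setminus\{0\}$, with $w_j$ discrete valuations of $R$, $b_j\in\mathbb{R}_{>0}$ and no $\frac{w_j}{b_j}$ omittable, then $s=t$ and, after reindexing, $v_i=w_i$ and $a_i=b_i$ for all $i$.)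
   Context: Rings are commutative with identity. A discrete valuation of $R$ is a map $v: R\to\mathbb{Z}\cup\{\infty\}$ obtained as follows: there are a minimal prime $P$ of $R$ and a rank 1 discrete valuation $v$ of the quotient field $\kappa(P)$ of $R/P$, with value group identified with $\mathbb{Z}$ (so $v$ is surjective from $\kappa(P)^{\times}$ onto $\mathbb{Z}$), nonnegative on $R/P$; for $r\in R$ set $v(r)$ to be the value of the image of $r$ in $R/P$ if $r\notin P$, and $v(r)=\infty$ if $r\in P$. Conventions: $\infty/a=\infty$ for $a\in\mathbb{R}_{>0}$. "No $v_i/a_i$ can be omitted" means that for each $i$, the function $f\mapsto\min_{j\ne i} v_j(f)/a_j$ on $R \setminus\{0\}$ is different from $\omega$ (the minimum over the empty set being $\infty$). *)

theory Defs
  imports "HOL-Algebra.QuotRing" "HOL-Algebra.Ring_Divisibility" "HOL-Library.Extended_Real"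
begin

section \<open>The field of fractions of a domain\<close>

text \<open>
  The fraction \<open>a/b\<close> is the equivalence class of the pair \<open>(a, b)\<close>. As is usual for quotient
  constructions, the operations are given as unions over all representatives; the lemmas below
  show that these unions do not depend on the representatives.
\<close>

definition fraction :: "('a, 'm) ring_scheme \<Rightarrow> 'a \<Rightarrow> 'a \<Rightarrow> ('a \<times> 'a) set" where
  "fraction D a b =
     {(c, d). c \<in> carrier D \<and> d \<in> carrier D - {\<zero>\<^bsub>D\<^esub>} \<and> a \<otimes>\<^bsub>D\<^esub> d = c \<otimes>\<^bsub>D\<^esub> b}"

definition fraction_field :: "('a, 'm) ring_scheme \<Rightarrow> ('a \<times> 'a) set ring" where
  "fraction_field D =
     \<lparr>carrier = {fraction D a b | a b. a \<in> carrier D \<and> b \<in> carrier D - {\<zero>\<^bsub>D\<^esub>}},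
      monoid.mult = (\<lambda>S T. \<Union>p\<in>S. \<Union>q\<in>T. fraction D (fst p \<otimes>\<^bsub>D\<^esub> fst q) (snd p \<otimes>\<^bsub>D\<^esub> snd q)),
      one = fraction D \<one>\<^bsub>D\<^esub> \<one>\<^bsub>D\<^esub>,
      zero = fraction D \<zero>\<^bsub>D\<^esub> \<one>\<^bsub>D\<^esub>,
      add = (\<lambda>S T. \<Union>p\<in>S. \<Union>q\<in>T.
               fraction D (fst p \<otimes>\<^bsub>D\<^esub> snd q \<oplus>\<^bsub>D\<^esub> fst q \<otimes>\<^bsub>D\<^esub> snd p)
                 (snd p \<otimes>\<^bsub>D\<^esub> snd q))\<rparr>"

context domain
begin

lemma fraction_trans:
  assumes "a \<in> carrier R" "c \<in> carrier R" "e \<in> carrier R"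
    and "b \<in> carrier R - {\<zero>}" "d \<in> carrier R - {\<zero>}" "f \<in> carrier R - {\<zero>}"
    and "a \<otimes> d = c \<otimes> b" "c \<otimes> f = e \<otimes> d"
  shows "a \<otimes> f = e \<otimes> b"
proof -
  have "d \<otimes> (a \<otimes> f) = (a \<otimes> d) \<otimes> f" using assms(1-6) by (auto simp: m_ac)
  also have "\<dots> = (c \<otimes> b) \<otimes> f" using assms(7) by simp
  also have "\<dots> = (c \<otimes> f) \<otimes> b" using assms(1-6) by (auto simp: m_ac)
  also have "\<dots> = (e \<otimes> d) \<otimes> b" using assms(8) by simp
  also have "\<dots> = d \<otimes> (e \<otimes> b)" using assms(1-6) by (auto simp: m_ac)
  finally show ?thesis using assms m_lcancel[of d "a \<otimes> f" "e \<otimes> b"] by auto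
qed

lemma fraction_eq_iff:
  assumes "a \<in> carrier R" "b \<in> carrier R - {\<zero>}" "c \<in> carrier R" "d \<in> carrier R - {\<zero>}"
  shows "fraction R a b = fraction R c d \<longleftrightarrow> a \<otimes> d = c \<otimes> b"
proof
  assume eq: "fraction R a b = fraction R c d"
  have "(c, d) \<in> fraction R c d" using assms by (simp add: fraction_def)
  then have "(c, d) \<in> fraction R a b" using eq by simp
  then show "a \<otimes> d = c \<otimes> b" by (simp add: fraction_def)
next
  assume eq: "a \<otimes> d = c \<otimes> b"
  have "a \<otimes> f = e \<otimes> b \<longleftrightarrow> c \<otimes> f = e \<otimes> d"
    if "e \<in> carrier R" "f \<in> carrier R - {\<zero>}" for e f
    using fraction_trans[of a c e b d f] fraction_trans[of c a e d b f] assms that eq by metis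
  then show "fraction R a b = fraction R c d" by (auto simp: fraction_def)
qed

lemma fraction_mem: "a \<in> carrier R \<Longrightarrow> b \<in> carrier R - {\<zero>} \<Longrightarrow> (a, b) \<in> fraction R a b"
  by (simp add: fraction_def)

lemma nonzero_mult: "b \<in> carrier R - {\<zero>} \<Longrightarrow> d \<in> carrier R - {\<zero>} \<Longrightarrow> b \<otimes> d \<in> carrier R - {\<zero>}"
  using integral by auto

lemma fraction_mult:
  assumes "a \<in> carrier R" "b \<in> carrier R - {\<zero>}" "c \<in> carrier R" "d \<in> carrier R - {\<zero>}"
  shows "fraction R a b \<otimes>\<^bsub>fraction_field R\<^esub> fraction R c d = fraction R (a \<otimes> c) (b \<otimes> d)"
proof -
  have *: "fraction R (a' \<otimes> c') (b' \<otimes> d') = fraction R (a \<otimes> c) (b \<otimes> d)"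
    if m: "(a', b') \<in> fraction R a b" "(c', d') \<in> fraction R c d" for a' b' c' d'
  proof -
    have c: "a' \<in> carrier R" "b' \<in> carrier R - {\<zero>}" "c' \<in> carrier R" "d' \<in> carrier R - {\<zero>}"
      and e: "a \<otimes> b' = a' \<otimes> b" "c \<otimes> d' = c' \<otimes> d"
      using m by (auto simp: fraction_def)
    have "(a' \<otimes> c') \<otimes> (b \<otimes> d) = (a' \<otimes> b) \<otimes> (c' \<otimes> d)"
      using c assms by (auto simp: m_ac)
    also have "\<dots> = (a \<otimes> b') \<otimes> (c \<otimes> d')" using e by simp
    also have "\<dots> = (a \<otimes> c) \<otimes> (b' \<otimes> d')"
      using c assms by (auto simp: m_ac)
    finally show ?thesis
      using c assms nonzero_mult[of b' d'] nonzero_mult[of b d] by (subst fraction_eq_iff) auto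
  qed
  have "fraction R a b \<otimes>\<^bsub>fraction_field R\<^esub> fraction R c d
      = (\<Union>p\<in>fraction R a b. \<Union>q\<in>fraction R c d. fraction R (a \<otimes> c) (b \<otimes> d))"
    unfolding fraction_field_def ring_record_simps by (intro SUP_cong refl *) simp_all
  also have "\<dots> = fraction R (a \<otimes> c) (b \<otimes> d)"
    using fraction_mem[OF assms(1,2)] fraction_mem[OF assms(3,4)] by auto
  finally show ?thesis .
qed

lemma fraction_add:
  assumes "a \<in> carrier R" "b \<in> carrier R - {\<zero>}" "c \<in> carrier R" "d \<in> carrier R - {\<zero>}"
  shows "fraction R a b \<oplus>\<^bsub>fraction_field R\<^esub> fraction R c d = fraction R (a \<otimes> d \<oplus> c \<otimes> b) (b \<otimes> d)"
proof -
  have *: "fraction R (a' \<otimes> d' \<oplus> c' \<otimes> b') (b' \<otimes> d') = fraction R (a \<otimes> d \<oplus> c \<otimes> b) (b \<otimes> d)"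
    if m: "(a', b') \<in> fraction R a b" "(c', d') \<in> fraction R c d" for a' b' c' d'
  proof -
    have c: "a' \<in> carrier R" "b' \<in> carrier R - {\<zero>}" "c' \<in> carrier R" "d' \<in> carrier R - {\<zero>}"
      and e: "a \<otimes> b' = a' \<otimes> b" "c \<otimes> d' = c' \<otimes> d"
      using m by (auto simp: fraction_def)
    have "(a' \<otimes> d' \<oplus> c' \<otimes> b') \<otimes> (b \<otimes> d)
        = (a' \<otimes> b) \<otimes> (d' \<otimes> d) \<oplus> (c' \<otimes> d) \<otimes> (b' \<otimes> b)"
      using c assms by (auto simp: m_ac l_distr r_distr)
    also have "\<dots> = (a \<otimes> b') \<otimes> (d' \<otimes> d) \<oplus> (c \<otimes> d') \<otimes> (b' \<otimes> b)" using e by simp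
    also have "\<dots> = (a \<otimes> d \<oplus> c \<otimes> b) \<otimes> (b' \<otimes> d')"
      using c assms by (auto simp: m_ac l_distr r_distr)
    finally show ?thesis
      using c assms nonzero_mult[of b' d'] nonzero_mult[of b d] by (subst fraction_eq_iff) auto
  qed
  have "fraction R a b \<oplus>\<^bsub>fraction_field R\<^esub> fraction R c d
      = (\<Union>p\<in>fraction R a b. \<Union>q\<in>fraction R c d. fraction R (a \<otimes> d \<oplus> c \<otimes> b) (b \<otimes> d))"
    unfolding fraction_field_def ring_record_simps by (intro SUP_cong refl *) simp_all
  also have "\<dots> = fraction R (a \<otimes> d \<oplus> c \<otimes> b) (b \<otimes> d)"
    using fraction_mem[OF assms(1,2)] fraction_mem[OF assms(3,4)] by auto
  finally show ?thesis .
qed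

lemma fraction_carrier:
  "a \<in> carrier R \<Longrightarrow> b \<in> carrier R - {\<zero>} \<Longrightarrow> fraction R a b \<in> carrier (fraction_field R)"
  by (auto simp: fraction_field_def)

lemma fraction_field_cases:
  assumes "x \<in> carrier (fraction_field R)"
  obtains a b where "a \<in> carrier R" "b \<in> carrier R - {\<zero>}" "x = fraction R a b"
  using assms by (auto simp: fraction_field_def)

lemma fraction_field_zero: "\<zero>\<^bsub>fraction_field R\<^esub> = fraction R \<zero> \<one>"
  and fraction_field_one: "\<one>\<^bsub>fraction_field R\<^esub> = fraction R \<one> \<one>"
  by (simp_all add: fraction_field_def)

lemma fraction_eq_zero_iff:
  "a \<in> carrier R \<Longrightarrow> b \<in> carrier R - {\<zero>} \<Longrightarrow> fraction R a b = \<zero>\<^bsub>fraction_field R\<^esub> \<longleftrightarrow> a = \<zero>"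
  by (simp add: fraction_field_zero fraction_eq_iff)

theorem fraction_field_is_field: "field (fraction_field R)"
proof -
  let ?K = "fraction_field R"
  have one: "\<one> \<in> carrier R - {\<zero>}" by simp
  have add: "abelian_group ?K"
  proof (rule abelian_groupI)
    fix x y assume "x \<in> carrier ?K" "y \<in> carrier ?K"
    then show "x \<oplus>\<^bsub>?K\<^esub> y \<in> carrier ?K"
      by (elim fraction_field_cases) (metis fraction_add fraction_carrier nonzero_mult DiffD1 m_closed a_closed)
  next
    show "\<zero>\<^bsub>?K\<^esub> \<in> carrier ?K" by (simp add: fraction_field_zero fraction_carrier)
  next
    fix x y z assume "x \<in> carrier ?K" "y \<in> carrier ?K" "z \<in> carrier ?K"
    then obtain a b c d e f where h: "a \<in> carrier R" "b \<in> carrier R - {\<zero>}" "c \<in> carrier R"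
      "d \<in> carrier R - {\<zero>}" "e \<in> carrier R" "f \<in> carrier R - {\<zero>}"
      and [simp]: "x = fraction R a b" "y = fraction R c d" "z = fraction R e f"
      by (elim fraction_field_cases) blast
    have n: "b \<otimes> d \<in> carrier R - {\<zero>}" "d \<otimes> f \<in> carrier R - {\<zero>}"
      using h nonzero_mult by blast+
    have "(a \<otimes> d \<oplus> c \<otimes> b) \<otimes> f \<oplus> e \<otimes> (b \<otimes> d) = a \<otimes> (d \<otimes> f) \<oplus> (c \<otimes> f \<oplus> e \<otimes> d) \<otimes> b"
      using h by (auto simp: m_ac a_ac l_distr r_distr)
    moreover have "b \<otimes> d \<otimes> f = b \<otimes> (d \<otimes> f)" using h by (auto simp: m_assoc)
    moreover have "b \<in> carrier R" "d \<in> carrier R" "f \<in> carrier R" using h by auto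
    ultimately show "x \<oplus>\<^bsub>?K\<^esub> y \<oplus>\<^bsub>?K\<^esub> z = x \<oplus>\<^bsub>?K\<^esub> (y \<oplus>\<^bsub>?K\<^esub> z)"
      using h n by (simp add: fraction_add del: Diff_iff)
  next
    fix x y assume "x \<in> carrier ?K" "y \<in> carrier ?K"
    then obtain a b c d where h: "a \<in> carrier R" "b \<in> carrier R - {\<zero>}" "c \<in> carrier R"
      "d \<in> carrier R - {\<zero>}" and [simp]: "x = fraction R a b" "y = fraction R c d"
      by (elim fraction_field_cases) blast
    have "a \<otimes> d \<oplus> c \<otimes> b = c \<otimes> b \<oplus> a \<otimes> d" "b \<otimes> d = d \<otimes> b"
      using h by (auto simp: m_ac a_ac)
    then show "x \<oplus>\<^bsub>?K\<^esub> y = y \<oplus>\<^bsub>?K\<^esub> x" using h by (simp add: fraction_add)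
  next
    fix x assume "x \<in> carrier ?K"
    then show "\<zero>\<^bsub>?K\<^esub> \<oplus>\<^bsub>?K\<^esub> x = x"
      by (elim fraction_field_cases) (simp add: fraction_field_zero fraction_add)
  next
    fix x assume "x \<in> carrier ?K"
    then obtain a b where h: "a \<in> carrier R" "b \<in> carrier R - {\<zero>}" and [simp]: "x = fraction R a b"
      by (elim fraction_field_cases) blast
    have "\<ominus> a \<otimes> b \<oplus> a \<otimes> b = \<zero>" using h by (simp add: l_minus l_neg)
    then have "fraction R (\<ominus> a) b \<oplus>\<^bsub>?K\<^esub> x = \<zero>\<^bsub>?K\<^esub>"
      using h nonzero_mult[of b b] by (simp add: fraction_add fraction_eq_zero_iff)
    then show "\<exists>y\<in>carrier ?K. y \<oplus>\<^bsub>?K\<^esub> x = \<zero>\<^bsub>?K\<^esub>"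
      using h fraction_carrier[of "\<ominus> a" b] by blast
  qed
  have mult: "comm_monoid ?K"
  proof (rule comm_monoidI)
    fix x y assume "x \<in> carrier ?K" "y \<in> carrier ?K"
    then show "x \<otimes>\<^bsub>?K\<^esub> y \<in> carrier ?K"
      by (elim fraction_field_cases) (metis fraction_mult fraction_carrier nonzero_mult m_closed)
  next
    show "\<one>\<^bsub>?K\<^esub> \<in> carrier ?K" by (simp add: fraction_field_one fraction_carrier)
  next
    fix x y z assume "x \<in> carrier ?K" "y \<in> carrier ?K" "z \<in> carrier ?K"
    then obtain a b c d e f where h: "a \<in> carrier R" "b \<in> carrier R - {\<zero>}" "c \<in> carrier R"
      "d \<in> carrier R - {\<zero>}" "e \<in> carrier R" "f \<in> carrier R - {\<zero>}"
      and [simp]: "x = fraction R a b" "y = fraction R c d" "z = fraction R e f"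
      by (elim fraction_field_cases) blast
    have n: "b \<otimes> d \<in> carrier R - {\<zero>}" "d \<otimes> f \<in> carrier R - {\<zero>}"
      using h nonzero_mult by blast+
    have "a \<otimes> c \<otimes> e = a \<otimes> (c \<otimes> e)" "b \<otimes> d \<otimes> f = b \<otimes> (d \<otimes> f)"
      using h by (auto simp: m_assoc)
    then show "x \<otimes>\<^bsub>?K\<^esub> y \<otimes>\<^bsub>?K\<^esub> z = x \<otimes>\<^bsub>?K\<^esub> (y \<otimes>\<^bsub>?K\<^esub> z)"
      using h n by (simp add: fraction_mult del: Diff_iff)
  next
    fix x assume "x \<in> carrier ?K"
    then show "\<one>\<^bsub>?K\<^esub> \<otimes>\<^bsub>?K\<^esub> x = x"
      by (elim fraction_field_cases) (simp add: fraction_field_one fraction_mult)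
  next
    fix x y assume "x \<in> carrier ?K" "y \<in> carrier ?K"
    then show "x \<otimes>\<^bsub>?K\<^esub> y = y \<otimes>\<^bsub>?K\<^esub> x"
      by (elim fraction_field_cases) (simp add: fraction_mult m_comm)
  qed
  have cring: "cring ?K"
  proof (rule cringI[OF add mult])
    fix x y z assume "x \<in> carrier ?K" "y \<in> carrier ?K" "z \<in> carrier ?K"
    then obtain a b c d e f where h: "a \<in> carrier R" "b \<in> carrier R - {\<zero>}" "c \<in> carrier R"
      "d \<in> carrier R - {\<zero>}" "e \<in> carrier R" "f \<in> carrier R - {\<zero>}"
      and [simp]: "x = fraction R a b" "y = fraction R c d" "z = fraction R e f"
      by (elim fraction_field_cases) blast
    have c: "b \<in> carrier R" "d \<in> carrier R" "f \<in> carrier R" using h by auto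
    have n1: "b \<otimes> d \<in> carrier R - {\<zero>}" "b \<otimes> f \<in> carrier R - {\<zero>}" "d \<otimes> f \<in> carrier R - {\<zero>}"
      using h nonzero_mult by blast+
    have n2: "b \<otimes> d \<otimes> f \<in> carrier R - {\<zero>}" "b \<otimes> f \<otimes> (d \<otimes> f) \<in> carrier R - {\<zero>}"
      using n1 h nonzero_mult by blast+
    have "(a \<otimes> d \<oplus> c \<otimes> b) \<otimes> e \<otimes> (b \<otimes> f \<otimes> (d \<otimes> f))
        = (a \<otimes> e \<otimes> (d \<otimes> f) \<oplus> c \<otimes> e \<otimes> (b \<otimes> f)) \<otimes> (b \<otimes> d \<otimes> f)"
      using h(1,3,5) c by (simp add: m_ac l_distr r_distr)
    then have "fraction R ((a \<otimes> d \<oplus> c \<otimes> b) \<otimes> e) (b \<otimes> d \<otimes> f)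
        = fraction R (a \<otimes> e \<otimes> (d \<otimes> f) \<oplus> c \<otimes> e \<otimes> (b \<otimes> f)) (b \<otimes> f \<otimes> (d \<otimes> f))"
      using h(1,3,5) c n2 by (subst fraction_eq_iff) (simp_all del: Diff_iff)
    moreover have "(x \<oplus>\<^bsub>?K\<^esub> y) \<otimes>\<^bsub>?K\<^esub> z = fraction R ((a \<otimes> d \<oplus> c \<otimes> b) \<otimes> e) (b \<otimes> d \<otimes> f)"
      using h c n1 n2 by (simp add: fraction_add fraction_mult del: Diff_iff)
    moreover have "x \<otimes>\<^bsub>?K\<^esub> z \<oplus>\<^bsub>?K\<^esub> y \<otimes>\<^bsub>?K\<^esub> z
        = fraction R (a \<otimes> e \<otimes> (d \<otimes> f) \<oplus> c \<otimes> e \<otimes> (b \<otimes> f)) (b \<otimes> f \<otimes> (d \<otimes> f))"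
      using h c n1 n2 by (simp add: fraction_add fraction_mult del: Diff_iff)
    ultimately show "(x \<oplus>\<^bsub>?K\<^esub> y) \<otimes>\<^bsub>?K\<^esub> z = x \<otimes>\<^bsub>?K\<^esub> z \<oplus>\<^bsub>?K\<^esub> y \<otimes>\<^bsub>?K\<^esub> z" by simp
  qed
  show ?thesis
  proof (rule cring.cring_fieldI2[OF cring])
    show "\<zero>\<^bsub>?K\<^esub> \<noteq> \<one>\<^bsub>?K\<^esub>"
      using fraction_eq_zero_iff[of \<one> \<one>] by (simp add: fraction_field_one)
  next
    fix x assume "x \<in> carrier ?K" "x \<noteq> \<zero>\<^bsub>?K\<^esub>"
    then obtain a b where h: "a \<in> carrier R - {\<zero>}" "b \<in> carrier R - {\<zero>}" and [simp]: "x = fraction R a b"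
      by (elim fraction_field_cases) (auto simp: fraction_eq_zero_iff)
    have "x \<otimes>\<^bsub>?K\<^esub> fraction R b a = \<one>\<^bsub>?K\<^esub>"
      using h nonzero_mult[of b a] by (simp add: fraction_mult fraction_field_one fraction_eq_iff m_comm)
    then show "\<exists>y\<in>carrier ?K. x \<otimes>\<^bsub>?K\<^esub> y = \<one>\<^bsub>?K\<^esub>" using h fraction_carrier[of b a] by blast
  qed
qed

end

section \<open>Discrete valuations of a ring\<close>

definition minimal_prime :: "'a set \<Rightarrow> ('a, 'm) ring_scheme \<Rightarrow> bool" where
  "minimal_prime P R \<longleftrightarrow>
     primeideal P R \<and> (\<forall>Q. primeideal Q R \<and> Q \<subseteq> P \<longrightarrow> Q = P)"

definition residue_field :: "('a, 'm) ring_scheme \<Rightarrow> 'a set \<Rightarrow> ('a set \<times> 'a set) set ring" where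
  "residue_field R P = fraction_field (R Quot P)"

text \<open>
  A rank 1 discrete valuation of a field, normalised to have value group \<open>\<int>\<close>. It is only
  considered on the nonzero elements.
\<close>

definition field_discrete_valuation :: "('k, 'm) ring_scheme \<Rightarrow> ('k \<Rightarrow> int) \<Rightarrow> bool" where
  "field_discrete_valuation K \<nu> \<longleftrightarrow>
     (\<forall>x\<in>carrier K - {\<zero>\<^bsub>K\<^esub>}. \<forall>y\<in>carrier K - {\<zero>\<^bsub>K\<^esub>}. \<nu> (x \<otimes>\<^bsub>K\<^esub> y) = \<nu> x + \<nu> y) \<and>
     (\<forall>x\<in>carrier K - {\<zero>\<^bsub>K\<^esub>}. \<forall>y\<in>carrier K - {\<zero>\<^bsub>K\<^esub>}.
        x \<oplus>\<^bsub>K\<^esub> y \<noteq> \<zero>\<^bsub>K\<^esub> \<longrightarrow> min (\<nu> x) (\<nu> y) \<le> \<nu> (x \<oplus>\<^bsub>K\<^esub> y)) \<and>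
     \<nu> ` (carrier K - {\<zero>\<^bsub>K\<^esub>}) = UNIV"

text \<open>
  The target \<open>\<int> \<union> {\<infinity>}\<close> is embedded in the extended reals. Only the values on \<open>carrier R\<close> matter.
  In \<open>residue_field R P\<close>, the element \<open>fraction (R Quot P) x \<one>\<close> is the image of \<open>x\<close> in \<open>R/P\<close>.
\<close>

definition discrete_valuation :: "('a, 'm) ring_scheme \<Rightarrow> ('a \<Rightarrow> ereal) \<Rightarrow> bool" where
  "discrete_valuation R v \<longleftrightarrow>
     (\<exists>P \<nu>. minimal_prime P R \<and>
        field_discrete_valuation (residue_field R P) \<nu> \<and>
        (\<forall>x\<in>carrier (R Quot P) - {\<zero>\<^bsub>R Quot P\<^esub>}. 0 \<le> \<nu> (fraction (R Quot P) x \<one>\<^bsub>R Quot P\<^esub>)) \<and>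
        (\<forall>r\<in>carrier R. v r =
           (if r \<in> P then \<infinity>
            else ereal (of_int (\<nu> (fraction (R Quot P) (P +>\<^bsub>R\<^esub> r) \<one>\<^bsub>R Quot P\<^esub>))))))"

section \<open>Minima of scaled valuations\<close>

text \<open>
  For finite \<open>I\<close> the infimum is a minimum, and the infimum over the empty set is \<open>\<infinity>\<close>.
\<close>

definition min_val :: "'i set \<Rightarrow> ('i \<Rightarrow> 'a \<Rightarrow> ereal) \<Rightarrow> ('i \<Rightarrow> real) \<Rightarrow> 'a \<Rightarrow> ereal" where
  "min_val I v a f = (INF i\<in>I. v i f / ereal (a i))"

definition none_omittable ::
  "('a, 'm) ring_scheme \<Rightarrow> 'i set \<Rightarrow> ('i \<Rightarrow> 'a \<Rightarrow> ereal) \<Rightarrow> ('i \<Rightarrow> real) \<Rightarrow> bool" where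
  "none_omittable R I v a \<longleftrightarrow>
     (\<forall>i\<in>I. \<exists>f\<in>carrier R - {\<zero>\<^bsub>R\<^esub>}. min_val (I - {i}) v a f \<noteq> min_val I v a f)"

end

theory Submission
  imports Defs
begin

text \<open>
  Multiplying by a high power of \<open>f\<close> isolates those \<open>v\<^sub>i/a\<^sub>i\<close> that attain the minimum at \<open>f\<close>:
  for large \<open>n\<close>, \<open>\<omega>(f\<^sup>ng) - n\<omega>(f)\<close> is (or, if infinite, tends to) the minimum at \<open>g\<close> over just
  these indices. So two families with the same minimum still have the same minimum after
  restriction to the indices that are minimal at \<open>f\<close>. Since \<open>v\<^sub>i/a\<^sub>i\<close> cannot be omitted, it is the only
  minimal one at some \<open>f\<close>; restricting at \<open>f\<close> and then at an analogous element for one of the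
  surviving \<open>w\<^sub>j/b\<^sub>j\<close> gives \<open>v\<^sub>i/a\<^sub>i = w\<^sub>j/b\<^sub>j\<close>. Both valuations have value group \<open>\<int>\<close>, so \<open>a\<^sub>i/b\<^sub>j\<close>
  and its inverse are integers.
\<close>

section \<open>Minima of additive functions\<close>

text \<open>Keeps what survives dividing a discrete valuation by a positive real, where integrality
  of the values is lost. The value at \<zero> is included because a product
  \<open>f [^] n \<otimes> g\<close> may vanish.\<close>

definition additive_val :: "('a, 'm) ring_scheme \<Rightarrow> ('a \<Rightarrow> ereal) \<Rightarrow> bool" where
  "additive_val R u \<longleftrightarrow>
     (\<forall>f\<in>carrier R. \<forall>g\<in>carrier R. u (f \<otimes>\<^bsub>R\<^esub> g) = u f + u g) \<and>
     (\<forall>f\<in>carrier R. 0 \<le> u f) \<and> u \<one>\<^bsub>R\<^esub> = 0 \<and> u \<zero>\<^bsub>R\<^esub> = \<infinity>"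

definition minimal_at :: "'i set \<Rightarrow> ('i \<Rightarrow> 'a \<Rightarrow> ereal) \<Rightarrow> 'a \<Rightarrow> 'i set" where
  "minimal_at I u f = {k \<in> I. u k f = (INF l\<in>I. u l f)}"

lemma additive_val_pow:
  assumes "cring R" "additive_val R u" "f \<in> carrier R"
  shows "u (f [^]\<^bsub>R\<^esub> (n::nat)) = ereal (real n) * u f"
proof -
  interpret cring R by fact
  have pos: "0 \<le> u f" using assms by (auto simp: additive_val_def)
  show ?thesis
  proof (induction n)
    case 0
    then show ?case using assms by (simp add: additive_val_def zero_ereal_def[symmetric])
  next
    case (Suc n)
    have "u (f [^]\<^bsub>R\<^esub> Suc n) = ereal (real n) * u f + u f"
      using assms Suc by (simp add: additive_val_def)
    also have "\<dots> = (ereal (real n) + 1) * u f"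
      using pos by (subst ereal_left_distrib) auto
    finally show ?case by (simp add: one_ereal_def add.commute)
  qed
qed

lemma additive_val_pow_mult:
  assumes "cring R" "additive_val R u" "f \<in> carrier R" "g \<in> carrier R"
  shows "u (f [^]\<^bsub>R\<^esub> (n::nat) \<otimes>\<^bsub>R\<^esub> g) = ereal (real n) * u f + u g"
proof -
  interpret cring R by fact
  have "u (f [^]\<^bsub>R\<^esub> n \<otimes>\<^bsub>R\<^esub> g) = u (f [^]\<^bsub>R\<^esub> n) + u g"
    using assms by (auto simp: additive_val_def)
  then show ?thesis using additive_val_pow[OF assms(1-3)] by simp
qed

section \<open>Restriction to the indices minimal at an element\<close>

lemma minimal_at_nonempty:
  assumes "finite I" "(INF k\<in>I. u k f) \<noteq> \<infinity>"
  shows "minimal_at I u f \<noteq> {}"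
proof -
  have "I \<noteq> {}" using assms by (auto simp: top_ereal_def)
  then have "(INF k\<in>I. u k f) = Min ((\<lambda>k. u k f) ` I)" "Min ((\<lambda>k. u k f) ` I) \<in> (\<lambda>k. u k f) ` I"
    using assms(1) by (auto simp: cInf_eq_Min intro!: Min_in)
  then show ?thesis by (auto simp: minimal_at_def)
qed

text \<open>Since \<open>u g\<close> is nonnegative, the value at the product is at least
  \<open>n * u f\<close>, whose slope exceeds \<open>m\<close>. This makes indices that are not
  minimal at \<open>f\<close> drop out.\<close>

lemma eventually_le_pow_mult:
  assumes "cring R" "additive_val R u" "f \<in> carrier R" "g \<in> carrier R" "ereal m < u f"
  shows "eventually (\<lambda>n. ereal (C + real n * m) \<le> u (f [^]\<^bsub>R\<^esub> n \<otimes>\<^bsub>R\<^esub> g)) sequentially"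
proof -
  \<comment> \<open>A real slope \<open>c\<close> strictly between exists even if \<open>u f\<close>
    is \<infinity>; then \<open>n * c\<close> passes \<open>C + n * m\<close> once \<open>n\<close>
    is at least \<open>C / (c - m)\<close>.\<close>
  obtain c where c: "ereal m < ereal c" "ereal c < u f"
    using ereal_dense2[OF assms(5)] by auto
  have "eventually (\<lambda>n. C / (c - m) \<le> real n) sequentially"
    using filterlim_real_sequentially by (simp add: filterlim_at_top)
  then show ?thesis
  proof eventually_elim
    case (elim n)
    have "C \<le> real n * (c - m)" using elim c by (simp add: divide_le_eq)
    then have "ereal (C + real n * m) \<le> ereal (real n) * ereal c"
      by (simp add: algebra_simps)
    also have "\<dots> \<le> ereal (real n) * u f"
      using c by (intro ereal_mult_left_mono) auto
    also have "\<dots> \<le> ereal (real n) * u f + u g"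
      using assms by (intro ereal_le_add_self) (auto simp: additive_val_def)
    also have "\<dots> = u (f [^]\<^bsub>R\<^esub> n \<otimes>\<^bsub>R\<^esub> g)"
      using additive_val_pow_mult[OF assms(1-4)] by simp
    finally show ?case .
  qed
qed

text \<open>Testing against real thresholds \<open>C\<close> replaces a limit and covers infinite
  values too. At a minimal index the summand \<open>n * m\<close> cancels exactly; any other index
  eventually imposes no condition. Finiteness of \<open>I\<close> lets one bound on \<open>n\<close>
  serve all indices.\<close>

lemma eventually_le_INF_pow_mult_iff:
  assumes "cring R" "finite I" "\<And>k. k \<in> I \<Longrightarrow> additive_val R (u k)"
    and "f \<in> carrier R" "g \<in> carrier R" "(INF k\<in>I. u k f) = ereal m"
  shows "eventually (\<lambda>n. ereal (C + real n * m) \<le> (INF k\<in>I. u k (f [^]\<^bsub>R\<^esub> n \<otimes>\<^bsub>R\<^esub> g)) \<longleftrightarrow>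
    ereal C \<le> (INF k\<in>minimal_at I u f. u k g)) sequentially"
proof -
  have "eventually (\<lambda>n. ereal (C + real n * m) \<le> u k (f [^]\<^bsub>R\<^esub> n \<otimes>\<^bsub>R\<^esub> g) \<longleftrightarrow>
      (k \<in> minimal_at I u f \<longrightarrow> ereal C \<le> u k g)) sequentially" if k: "k \<in> I" for k
  proof (cases "u k f = ereal m")
    case True
    have "ereal (C + real n * m) \<le> u k (f [^]\<^bsub>R\<^esub> n \<otimes>\<^bsub>R\<^esub> g) \<longleftrightarrow> ereal C \<le> u k g" for n
      using additive_val_pow_mult[OF assms(1) assms(3)[OF k] assms(4,5), of n] True
      by (cases "u k g") auto
    then show ?thesis using True k assms(6) by (simp add: minimal_at_def)
  next
    case False
    then have "ereal m < u k f"
      using INF_lower[OF k, of "\<lambda>k. u k f"] assms(6) by simp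
    from eventually_le_pow_mult[OF assms(1) assms(3)[OF k] assms(4,5) this, of C] False assms(6)
    show ?thesis by (simp add: minimal_at_def)
  qed
  then have "eventually (\<lambda>n. \<forall>k\<in>I. ereal (C + real n * m) \<le> u k (f [^]\<^bsub>R\<^esub> n \<otimes>\<^bsub>R\<^esub> g) \<longleftrightarrow>
      (k \<in> minimal_at I u f \<longrightarrow> ereal C \<le> u k g)) sequentially"
    using assms(2) by (simp add: eventually_ball_finite)
  moreover have "minimal_at I u f \<subseteq> I" by (auto simp: minimal_at_def)
  ultimately show ?thesis
    by (auto elim!: eventually_mono simp: le_INF_iff)
qed

text \<open>For each threshold, the two families give the same condition at
  \<open>f [^] n \<otimes> g\<close> for every \<open>n\<close>; for large \<open>n\<close> it is
  the condition on either restricted minimum.\<close>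

lemma INF_minimal_at_eq:
  assumes "cring R" "finite I" "finite J"
    and "\<And>k. k \<in> I \<Longrightarrow> additive_val R (u k)" "\<And>k. k \<in> J \<Longrightarrow> additive_val R (y k)"
    and eq: "\<And>g. g \<in> carrier R \<Longrightarrow> (INF k\<in>I. u k g) = (INF k\<in>J. y k g)"
    and f: "f \<in> carrier R" "(INF k\<in>I. u k f) = ereal m" and g: "g \<in> carrier R"
  shows "(INF k\<in>minimal_at I u f. u k g) = (INF k\<in>minimal_at J y f. y k g)" (is "?A = ?B")
proof -
  interpret cring R by fact
  have *: "ereal C \<le> ?A \<longleftrightarrow> ereal C \<le> ?B" for C
  proof -
    have fJ: "(INF k\<in>J. y k f) = ereal m" using eq f by simp
    have *: "eventually (\<lambda>n. ereal (C + real n * m) \<le> (INF k\<in>I. u k (f [^]\<^bsub>R\<^esub> n \<otimes>\<^bsub>R\<^esub> g)) \<longleftrightarrow>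
        ereal C \<le> ?A) sequentially"
      using assms by (intro eventually_le_INF_pow_mult_iff) auto
    have **: "eventually (\<lambda>n. ereal (C + real n * m) \<le> (INF k\<in>J. y k (f [^]\<^bsub>R\<^esub> n \<otimes>\<^bsub>R\<^esub> g)) \<longleftrightarrow>
        ereal C \<le> ?B) sequentially"
      using assms fJ by (intro eventually_le_INF_pow_mult_iff) auto
    have eqn: "(INF k\<in>I. u k (f [^]\<^bsub>R\<^esub> n \<otimes>\<^bsub>R\<^esub> g)) = (INF k\<in>J. y k (f [^]\<^bsub>R\<^esub> n \<otimes>\<^bsub>R\<^esub> g))"
      for n :: nat
      using f g by (intro eq) auto
    \<comment> \<open>Here \<open>n\<close> no longer occurs, so holding eventually means
      holding.\<close>
    have "eventually (\<lambda>n::nat. ereal C \<le> ?A \<longleftrightarrow> ereal C \<le> ?B) sequentially"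
      using * **
      by eventually_elim (auto simp: eqn)
    then show ?thesis by simp
  qed
  \<comment> \<open>An extended real is determined by the reals below it.\<close>
  have "A \<le> B" if "\<And>C. ereal C \<le> A \<Longrightarrow> ereal C \<le> B" for A B
    using that by (metis ereal_dense2 less_imp_le not_le)
  then show ?thesis using * by (intro antisym) blast+
qed

section \<open>Isolating a single component\<close>

lemma minimal_at_singleton: "minimal_at {i} u f = {i}"
  by (auto simp: minimal_at_def)

text \<open>The subset \<open>J\<close> allows two uses: on a full family, and on what a first
  restriction leaves of it.\<close>

lemma minimal_at_eq_singleton:
  assumes "i \<in> J" "J \<subseteq> I" "u i f < (INF k\<in>I - {i}. u k f)"
  shows "minimal_at J u f = {i}" "(INF k\<in>J. u k f) = u i f"
proof -
  have less: "u i f < u k f" if "k \<in> J - {i}" for k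
    using less_INF_D[OF assms(3)] that assms(2) by auto
  then show INF: "(INF k\<in>J. u k f) = u i f"
    using assms(1) by (intro antisym INF_lower INF_greatest) (auto intro: less_imp_le)
  show "minimal_at J u f = {i}"
    unfolding minimal_at_def INF using assms(1) less by force
qed

lemma ereal_eq_less:
  assumes "0 \<le> (x::ereal)" "x < z"
  obtains m where "x = ereal m"
  using assms by (cases x) auto

lemma ex_equal_component:
  assumes R: "cring R" and fin: "finite I" "finite J"
    and u: "\<And>k. k \<in> I \<Longrightarrow> additive_val R (u k)" and y: "\<And>k. k \<in> J \<Longrightarrow> additive_val R (y k)"
    and eq: "\<And>g. g \<in> carrier R \<Longrightarrow> (INF k\<in>I. u k g) = (INF k\<in>J. y k g)"
    and irred_I: "\<And>i. i \<in> I \<Longrightarrow> \<exists>f\<in>carrier R. u i f < (INF k\<in>I - {i}. u k f)"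
    and irred_J: "\<And>j. j \<in> J \<Longrightarrow> \<exists>f\<in>carrier R. y j f < (INF k\<in>J - {j}. y k f)"
    and i: "i \<in> I"
  shows "\<exists>j\<in>J. \<forall>g\<in>carrier R. u i g = y j g"
proof -
  obtain f where f: "f \<in> carrier R" "u i f < (INF k\<in>I - {i}. u k f)"
    using irred_I[OF i] by blast
  obtain m where m: "u i f = ereal m"
    using f u[OF i] ereal_eq_less by (metis additive_val_def)
  note If = minimal_at_eq_singleton[OF i subset_refl[of I], of u f, OF f(2)]
  \<comment> \<open>The first family shrinks to \<open>{i}\<close> at \<open>f\<close>, but
    \<open>J'\<close> may still have several elements, so a second restriction follows.\<close>
  define J' where "J' = minimal_at J y f"
  have J': "J' \<subseteq> J" "finite J'" using fin by (auto simp: J'_def minimal_at_def)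
  have eq': "(INF k\<in>{i}. u k g) = (INF k\<in>J'. y k g)" if "g \<in> carrier R" for g
    using INF_minimal_at_eq[OF R fin u y eq f(1) _ that, of m] If m by (simp add: J'_def)
  have "J' \<noteq> {}"
    unfolding J'_def using fin(2) eq[OF f(1)] If m by (intro minimal_at_nonempty) auto
  then obtain j where j: "j \<in> J'" by blast
  obtain h where h: "h \<in> carrier R" "y j h < (INF k\<in>J - {j}. y k h)"
    using irred_J j J' by blast
  obtain l where l: "y j h = ereal l"
    using h y j J' ereal_eq_less by (metis additive_val_def subsetD)
  note Jh = minimal_at_eq_singleton[OF j J'(1), of y h, OF h(2)]
  \<comment> \<open>Restricting again needs a finite minimum at \<open>h\<close>, and
    \<open>eq'\<close> carries it over from \<open>y j h\<close>. Then \<open>J'\<close> shrinks to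
    \<open>{j}\<close>, while \<open>{i}\<close> stays.\<close>
  have "(INF k\<in>{i}. u k h) = ereal l" using eq'[OF h(1)] Jh l by simp
  then have "(INF k\<in>minimal_at {i} u h. u k g) = (INF k\<in>minimal_at J' y h. y k g)"
    if "g \<in> carrier R" for g
    using u i y J'(1) by (intro INF_minimal_at_eq[OF R _ J'(2) _ _ eq' h(1) _ that]) auto
  then show ?thesis
    using j J' Jh by (auto simp: minimal_at_singleton)
qed

section \<open>Discrete valuations\<close>

text \<open>Surjectivity onto \<int> holds on the residue field, not on \<open>R\<close>: the t-adic
  valuation on k[t^2, t^3] never takes the value 1. Its trace on \<open>R\<close> is a pair of
  elements with consecutive values.\<close>

lemma discrete_valuation_props:
  fixes R :: "('a, 'm) ring_scheme" (structure)
  assumes R: "cring R" and v: "discrete_valuation R v"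
  shows discrete_valuation_additive: "additive_val R v"
    and discrete_valuation_range: "f \<in> carrier R \<Longrightarrow> v f = \<infinity> \<or> (\<exists>n::int. v f = ereal (of_int n))"
    and discrete_valuation_surj: "\<exists>x\<in>carrier R. \<exists>y\<in>carrier R. \<exists>n::int.
          v y = ereal (of_int n) \<and> v x = ereal (of_int n + 1)"
proof -
  interpret cring R by fact
  obtain P \<nu> where P: "minimal_prime P R"
    and \<nu>: "field_discrete_valuation (residue_field R P) \<nu>"
    and pos: "\<forall>x\<in>carrier (R Quot P) - {\<zero>\<^bsub>R Quot P\<^esub>}. 0 \<le> \<nu> (fraction (R Quot P) x \<one>\<^bsub>R Quot P\<^esub>)"
    and val: "\<forall>r\<in>carrier R. v r = (if r \<in> P then \<infinity>
            else ereal (of_int (\<nu> (fraction (R Quot P) (P +>\<^bsub>R\<^esub> r) \<one>\<^bsub>R Quot P\<^esub>))))"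
    using v unfolding discrete_valuation_def by blast
  interpret P: primeideal P R using P by (simp add: minimal_prime_def)
  interpret D: domain "R Quot P" by (rule P.quotient_is_domain)
  let ?D = "R Quot P" and ?K = "residue_field R P"
  interpret K: field ?K unfolding residue_field_def by (rule D.fraction_field_is_field)
  define \<phi> where "\<phi> r = fraction ?D (P +> r) \<one>\<^bsub>?D\<^esub>" for r
  have coset: "P +> r \<in> carrier ?D" if "r \<in> carrier R" for r
    using that P.rcos_ring_hom ring_hom_closed by metis
  have coset0: "P +> r = \<zero>\<^bsub>?D\<^esub> \<longleftrightarrow> r \<in> P" if "r \<in> carrier R" for r
    using that P.ideal_axioms by (metis FactRing_def P.Icarr P.a_rcos_const P.a_rcos_self ring_record_simps(11))
  have coset_mult: "P +> (r \<otimes> s) = (P +> r) \<otimes>\<^bsub>?D\<^esub> (P +> s)" if "r \<in> carrier R" "s \<in> carrier R" for r s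
    using that P.rcos_ring_hom ring_hom_mult by metis
  have coset1: "P +> \<one> = \<one>\<^bsub>?D\<^esub>" by (simp add: FactRing_def)
  have \<phi>K: "\<phi> r \<in> carrier ?K - {\<zero>\<^bsub>?K\<^esub>}" if "r \<in> carrier R" "r \<notin> P" for r
    unfolding \<phi>_def residue_field_def using that coset coset0
    by (simp add: D.fraction_eq_zero_iff D.fraction_carrier)
  have \<phi>_mult: "\<phi> (r \<otimes> s) = \<phi> r \<otimes>\<^bsub>?K\<^esub> \<phi> s" if "r \<in> carrier R" "s \<in> carrier R" for r s
    unfolding \<phi>_def residue_field_def using that coset coset_mult by (simp add: D.fraction_mult)
  have \<nu>_mult: "\<nu> (x \<otimes>\<^bsub>?K\<^esub> y) = \<nu> x + \<nu> y"
    if "x \<in> carrier ?K - {\<zero>\<^bsub>?K\<^esub>}" "y \<in> carrier ?K - {\<zero>\<^bsub>?K\<^esub>}" for x y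
    using \<nu> that by (simp add: field_discrete_valuation_def)
  have val': "v r = (if r \<in> P then \<infinity> else ereal (of_int (\<nu> (\<phi> r))))" if "r \<in> carrier R" for r
    using val that by (simp add: \<phi>_def)
  \<comment> \<open>Makes the value \<infinity> on \<open>P\<close> compatible with products in both
    directions.\<close>
  have prime: "r \<otimes> s \<in> P \<longleftrightarrow> r \<in> P \<or> s \<in> P" if "r \<in> carrier R" "s \<in> carrier R" for r s
    using that P.I_l_closed P.I_r_closed P.I_prime by blast
  have mult: "v (r \<otimes> s) = v r + v s" if "r \<in> carrier R" "s \<in> carrier R" for r s
    using that prime[OF that] \<nu>_mult[OF \<phi>K \<phi>K, of r s] by (auto simp: val' \<phi>_mult)
  have nonneg: "0 \<le> v r" if "r \<in> carrier R" for r
  proof (cases "r \<in> P")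
    case False
    then have "0 \<le> \<nu> (\<phi> r)" using pos coset[OF that] coset0[OF that] unfolding \<phi>_def by blast
    then show ?thesis using that False by (simp add: val')
  qed (simp add: that val')
  have one: "\<one> \<notin> P" using P.I_notcarr P.one_imp_carrier by blast
  then have "\<nu> (\<phi> \<one>) = 0" using \<nu>_mult[of "\<phi> \<one>" "\<phi> \<one>"] \<phi>_mult[of \<one> \<one>] \<phi>K[of \<one>] by simp
  then have "v \<one> = 0" using one by (simp add: val' zero_ereal_def)
  moreover have "v \<zero> = \<infinity>" by (simp add: val')
  ultimately show "additive_val R v" using mult nonneg by (auto simp: additive_val_def)
  show "v f = \<infinity> \<or> (\<exists>n::int. v f = ereal (of_int n))" if "f \<in> carrier R" using that by (auto simp: val')
  \<comment> \<open>Take a uniformizer \<open>z\<close>, write it as a fraction of cosets and lift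
    numerator and denominator to \<open>x\<close> and \<open>y\<close>; clearing the denominator
    gives values differing by 1.\<close>
  have "1 \<in> \<nu> ` (carrier ?K - {\<zero>\<^bsub>?K\<^esub>})" using \<nu> by (simp add: field_discrete_valuation_def)
  then obtain z where z: "z \<in> carrier ?K - {\<zero>\<^bsub>?K\<^esub>}" "\<nu> z = 1" by (auto simp: image_iff)
  then obtain c d where cd: "c \<in> carrier ?D" "d \<in> carrier ?D - {\<zero>\<^bsub>?D\<^esub>}" "z = fraction ?D c d"
    unfolding residue_field_def by (blast elim: D.fraction_field_cases)
  obtain x y where xy: "x \<in> carrier R" "c = P +> x" "y \<in> carrier R" "d = P +> y"
    using cd by (auto simp: FactRing_def A_RCOSETS_def')
  have y: "y \<notin> P" using cd xy coset0 by auto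
  have "z \<otimes>\<^bsub>?K\<^esub> \<phi> y = fraction ?D (c \<otimes>\<^bsub>?D\<^esub> d) d"
    unfolding \<phi>_def residue_field_def using cd xy by (simp add: D.fraction_mult)
  also have "\<dots> = \<phi> x"
    unfolding \<phi>_def using cd xy(2) by (subst D.fraction_eq_iff) auto
  finally have x: "\<phi> x = z \<otimes>\<^bsub>?K\<^esub> \<phi> y" by simp
  then have nz: "\<phi> x \<noteq> \<zero>\<^bsub>?K\<^esub>" using z(1) \<phi>K[OF xy(3) y] by (simp add: K.integral_iff)
  have "\<phi> x = \<zero>\<^bsub>?K\<^esub> \<longleftrightarrow> x \<in> P"
    unfolding \<phi>_def residue_field_def using coset[OF xy(1)] coset0[OF xy(1)]
    by (simp add: D.fraction_eq_zero_iff)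
  with nz have x_notin: "x \<notin> P" by simp
  have "\<nu> (\<phi> x) = 1 + \<nu> (\<phi> y)" using x z(2) \<nu>_mult[OF z(1) \<phi>K[OF xy(3) y]] by simp
  then have "v y = ereal (of_int (\<nu> (\<phi> y))) \<and> v x = ereal (of_int (\<nu> (\<phi> y)) + 1)"
    using xy(1,3) x_notin y by (simp add: val' add.commute)
  then show "\<exists>x\<in>carrier R. \<exists>y\<in>carrier R. \<exists>n::int.
      v y = ereal (of_int n) \<and> v x = ereal (of_int n + 1)"
    using xy(1,3) by blast
qed

section \<open>Rigidity of the scaling factors\<close>

lemma additive_val_scale:
  assumes "additive_val R v" "a > 0"
  shows "additive_val R (\<lambda>f. v f / ereal a)"
proof -
  have "(x + y) / ereal a = x / ereal a + y / ereal a" if "0 \<le> x" "0 \<le> y" for x y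
    using that assms(2) by (simp add: divide_ereal_def ereal_left_distrib)
  then show ?thesis
    using assms by (auto simp: additive_val_def)
qed

text \<open>Where \<open>v\<close> increases by 1, \<open>w\<close> increases by
  \<open>b / a\<close>, which is therefore an integer.\<close>

lemma scaled_valuations_dvd:
  assumes "cring R" "discrete_valuation R v" "discrete_valuation R w" "a > 0" "b > 0"
    and eq: "\<And>f. f \<in> carrier R \<Longrightarrow> v f / ereal a = w f / ereal b"
  shows "\<exists>k::int. b = of_int k * a"
proof -
  obtain x y n where xy: "x \<in> carrier R" "y \<in> carrier R"
    "v y = ereal (of_int n)" "v x = ereal (of_int n + 1)"
    using discrete_valuation_surj[OF assms(1,2)] by blast
  have "w x \<noteq> \<infinity>" "w y \<noteq> \<infinity>" using eq[OF xy(1)] eq[OF xy(2)] xy assms(4,5) by auto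
  then obtain p q :: int where pq: "w x = ereal (of_int p)" "w y = ereal (of_int q)"
    using discrete_valuation_range[OF assms(1,3)] xy by metis
  have "(of_int n + 1) / a = of_int p / b" "of_int n / a = of_int q / b"
    using eq[OF xy(1)] eq[OF xy(2)] xy pq assms(4,5) by auto
  then have "b = of_int (p - q) * a"
    using assms(4,5) by (simp add: field_simps)
  then show ?thesis by blast
qed

text \<open>Each of \<open>a\<close> and \<open>b\<close> is an integer multiple of the other;
  positivity makes both factors at least 1.\<close>

lemma scaled_valuations_eq:
  assumes "cring R" "discrete_valuation R v" "discrete_valuation R w" "a > 0" "b > 0"
    and eq: "\<And>f. f \<in> carrier R \<Longrightarrow> v f / ereal a = w f / ereal b"
  shows "a = b" "f \<in> carrier R \<Longrightarrow> v f = w f"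
proof -
  obtain k l :: int where kl: "b = of_int k * a" "a = of_int l * b"
    using scaled_valuations_dvd[OF assms] scaled_valuations_dvd[OF assms(1,3,2,5,4) eq[symmetric]]
    by blast
  have "0 < of_int k * a" "0 < of_int l * b" using assms(4,5) by (simp_all only: kl[symmetric])
  then have "k \<ge> 1" "l \<ge> 1"
    using assms(4,5) by (simp_all add: zero_less_mult_iff)
  then have "1 * a \<le> of_int k * a" "1 * b \<le> of_int l * b"
    using assms(4,5) by (intro mult_right_mono; simp)+
  then have "a \<le> b" "b \<le> a" by (simp_all only: kl[symmetric] mult_1)
  then show "a = b" by simp
  then show "v f = w f" if "f \<in> carrier R"
    using eq[OF that] assms(4) by (cases "v f"; cases "w f") auto
qed

section \<open>Matching the two families\<close>

lemma none_omittable_INF: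
  assumes "none_omittable R I v a" "i \<in> I"
  shows "\<exists>f\<in>carrier R. v i f / ereal (a i) < (INF k\<in>I - {i}. v k f / ereal (a k))"
proof -
  obtain f where f: "f \<in> carrier R" "min_val (I - {i}) v a f \<noteq> min_val I v a f"
    using assms by (auto simp: none_omittable_def)
  \<comment> \<open>If omitting \<open>i\<close> changes this binary minimum, the
    \<open>i\<close>-th term must lie strictly below all the rest.\<close>
  have "min_val I v a f = min (v i f / ereal (a i)) (min_val (I - {i}) v a f)"
    using INF_insert[of "\<lambda>k. v k f / ereal (a k)" i "I - {i}"] assms(2)
    by (simp add: min_val_def insert_absorb inf_min)
  then have "v i f / ereal (a i) < min_val (I - {i}) v a f"
    using f(2) by (auto simp: min_def split: if_splits)
  then show ?thesis using f(1) by (auto simp: min_val_def)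
qed

lemma ex_equal_valuation:
  assumes R: "cring R" and fin: "finite I" "finite J"
    and v: "\<And>i. i \<in> I \<Longrightarrow> discrete_valuation R (v i)" "\<And>i. i \<in> I \<Longrightarrow> a i > 0"
    and w: "\<And>j. j \<in> J \<Longrightarrow> discrete_valuation R (w j)" "\<And>j. j \<in> J \<Longrightarrow> b j > 0"
    and eq: "\<And>f. f \<in> carrier R - {\<zero>\<^bsub>R\<^esub>} \<Longrightarrow> min_val I v a f = min_val J w b f"
    and irred: "none_omittable R I v a" "none_omittable R J w b"
  shows "\<exists>\<pi>. \<pi> ` I \<subseteq> J \<and> inj_on \<pi> I \<and>
    (\<forall>i\<in>I. a i = b (\<pi> i) \<and> (\<forall>f\<in>carrier R. v i f = w (\<pi> i) f))"
proof -
  define u where "u i f = v i f / ereal (a i)" for i f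
  define y where "y j f = w j f / ereal (b j)" for j f
  have u: "additive_val R (u i)" if "i \<in> I" for i
    unfolding u_def using that R v by (intro additive_val_scale discrete_valuation_additive)
  have y: "additive_val R (y j)" if "j \<in> J" for j
    unfolding y_def using that R w by (intro additive_val_scale discrete_valuation_additive)
  have uI: "\<exists>f\<in>carrier R. u i f < (INF k\<in>I - {i}. u k f)" if "i \<in> I" for i
    unfolding u_def by (rule none_omittable_INF[OF irred(1) that])
  have yJ: "\<exists>f\<in>carrier R. y j f < (INF k\<in>J - {j}. y k f)" if "j \<in> J" for j
    unfolding y_def by (rule none_omittable_INF[OF irred(2) that])
  have "(INF i\<in>I. u i f) = (INF j\<in>J. y j f)" if "f \<in> carrier R" for f
  \<comment> \<open>The hypothesis speaks of nonzero elements only; at \<zero> both infima are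
    \<infinity>, even over an empty index set.\<close>
  proof (cases "f = \<zero>\<^bsub>R\<^esub>")
    case True
    have "(INF i\<in>I. u i f) = (INF i\<in>I. \<infinity>)" "(INF j\<in>J. y j f) = (INF j\<in>J. \<infinity>)"
      using u y True by (auto simp: additive_val_def intro!: INF_cong)
    then show ?thesis by (simp add: top_ereal_def[symmetric])
  next
    case False
    then show ?thesis using eq[of f] that by (simp add: min_val_def u_def y_def)
  qed
  then have "\<forall>i\<in>I. \<exists>j. j \<in> J \<and> (\<forall>g\<in>carrier R. u i g = y j g)"
    using ex_equal_component[OF R fin u y _ uI yJ] by blast
  then obtain \<pi> where \<pi>: "\<And>i. i \<in> I \<Longrightarrow> \<pi> i \<in> J"
    and uy: "\<And>i g. i \<in> I \<Longrightarrow> g \<in> carrier R \<Longrightarrow> u i g = y (\<pi> i) g"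
    by metis
  \<comment> \<open>Two indices with the same image have equal scaled valuations, so neither could
    be the strict minimum anywhere.\<close>
  have "inj_on \<pi> I"
  proof (rule inj_onI, rule ccontr)
    fix i k assume ik: "i \<in> I" "k \<in> I" "\<pi> i = \<pi> k" "i \<noteq> k"
    obtain f where f: "f \<in> carrier R" "u i f < (INF k\<in>I - {i}. u k f)" using uI ik by blast
    have "u i f < u k f" using less_INF_D[OF f(2)] ik by simp
    then show False using uy ik f by simp
  qed
  moreover have "a i = b (\<pi> i) \<and> (\<forall>f\<in>carrier R. v i f = w (\<pi> i) f)" if i: "i \<in> I" for i
    using scaled_valuations_eq[OF R v(1)[OF i] w(1)[OF \<pi>[OF i]] v(2)[OF i] w(2)[OF \<pi>[OF i]]]
      uy[OF i] by (auto simp: u_def y_def)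
  ultimately show ?thesis using \<pi> by blast
qed

theorem theorem6p5:
  fixes R :: "('a, 'm) ring_scheme"
    and v w :: "nat \<Rightarrow> 'a \<Rightarrow> ereal"
    and a b :: "nat \<Rightarrow> real"
    and s t :: nat
    and \<omega> :: "'a \<Rightarrow> ereal"
  assumes "cring R" and "noetherian_ring R"
    and "\<And>i. i \<in> {1..s} \<Longrightarrow> discrete_valuation R (v i)"
    and "\<And>i. i \<in> {1..s} \<Longrightarrow> a i > 0"
    and "\<And>f. f \<in> carrier R - {\<zero>\<^bsub>R\<^esub>} \<Longrightarrow> \<omega> f = min_val {1..s} v a f"
    and "none_omittable R {1..s} v a"
    and "\<And>j. j \<in> {1..t} \<Longrightarrow> discrete_valuation R (w j)"
    and "\<And>j. j \<in> {1..t} \<Longrightarrow> b j > 0"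
    and "\<And>f. f \<in> carrier R - {\<zero>\<^bsub>R\<^esub>} \<Longrightarrow> \<omega> f = min_val {1..t} w b f"
    and "none_omittable R {1..t} w b"
  shows "s = t \<and>
    (\<exists>\<pi>. bij_betw \<pi> {1..s} {1..t} \<and>
       (\<forall>i\<in>{1..s}. a i = b (\<pi> i) \<and> (\<forall>f\<in>carrier R. v i f = w (\<pi> i) f)))"
proof -
  have eq: "min_val {1..s} v a f = min_val {1..t} w b f" if "f \<in> carrier R - {\<zero>\<^bsub>R\<^esub>}" for f
    using assms(5,9) that by metis
  obtain \<pi> where \<pi>: "\<pi> ` {1..s} \<subseteq> {1..t}" "inj_on \<pi> {1..s}"
    "\<forall>i\<in>{1..s}. a i = b (\<pi> i) \<and> (\<forall>f\<in>carrier R. v i f = w (\<pi> i) f)"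
    using ex_equal_valuation[OF assms(1) _ _ assms(3,4,7,8) eq assms(6,10)] by auto
  \<comment> \<open>Exchanging the families gives an injection back, so \<open>s = t\<close>, and an
    injection between equal finite sets is bijective.\<close>
  obtain \<rho> where \<rho>: "\<rho> ` {1..t} \<subseteq> {1..s}" "inj_on \<rho> {1..t}"
    using ex_equal_valuation[OF assms(1) _ _ assms(7,8,3,4) eq[symmetric] assms(10,6)] by auto
  have "s = t"
    using card_inj_on_le[OF \<pi>(2,1)] card_inj_on_le[OF \<rho>(2,1)] by simp
  moreover from this have "bij_betw \<pi> {1..s} {1..t}"
    using \<pi> endo_inj_surj[of "{1..s}" \<pi>] by (simp add: bij_betw_def)
  ultimately show ?thesis using \<pi>(3) by blast
qed

end
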